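(* Let $\phi,\eta\in\mathcal G_1$ and assume that there is a constant $C_0>0$ such that $$\int_r^\infty \frac{\phi(x,s)}{\eta(x,s)\,s}\,ds\le C_0\,\frac{\phi(x,r)}{\eta(x,r)}\qquad (x\in\mathbb R^n,\ r>0).$$ Then there is a constant $C>0$ such that the following holds. Assume that $\{Q_j\}_{j=1}^\infty\subset\mathcal Q(\mathbb R^n)$, $\{a_j\}_{j=1}^\infty\subset\mathcal M_{1,\eta}(\mathbb R^n)$ and $\{\lambda_j\}_{j=1}^\infty\subset[0,\infty)$ satisfy $$\|a_j\|_{\mathcal M_{1,\eta}}\le\frac{1}{\eta(Q_j)},\qquad \operatorname{supp}(a_j)\subset Q_j\quad (j\in\mathbb N),\qquad \Big\|\sum_{j=1}^\infty\lambda_j\chi_{Q_j}\Big\|_{\mathcal M_{1,\phi}}<\infty .$$ Then $f\equiv\sum_{j=1}^\infty\lambda_j a_j$ converges absolutely in $L^1_{\rm loc}(\mathbb R^n)$ and satisfies $$\|f\|_{\mathcal M_{1,\phi}}\le C\Big\|\sum_{j=1}^\infty\lambda_j\chi_{Q_j}\Big\|_{\mathcal M_{1,\phi}} .$$ Here $C$ does not depend on $\{Q_j\},\{a_j\},\{\lambda_j\}$.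
   Context: $\mathcal Q(\mathbb R^n)=\mathcal Q$ is the set of all compact cubes in $\mathbb R^n$ with sides parallel to the coordinate axes. For a cube $Q$, $c(Q)$ is its center, $\ell(Q)=|Q|^{1/n}$ its side-length, $\chi_Q$ its indicator function. For a function $\phi:\mathbb R^n\times(0,\infty)\to(0,\infty)$ write $\phi(Q)=\phi(c(Q),\ell(Q))$. For $0<p<\infty$, $\mathcal G_p$ is the set of all functions $\phi:\mathbb R^n\times(0,\infty)\to(0,\infty)$ for which there is $C>0$ with $\phi(x,r)\le\phi(x,s)$ and $C\phi(x,r)r^{n/p}\ge\phi(x,s)s^{n/p}$ for all $x\in\mathbb R^n$ and $0<s\le r<\infty$. Standing assumption: every $\phi\in\mathcal G_p$ under consideration also satisfies $\phi(y,s)s^{n/p}\le\phi(x,r)r^{n/p}$ for all $x,y\in\mathbb R^n$ and $r,s>0$ with $\|x-y\|_\infty\le r-s$. For $0<p<\infty$ the generalized Morrey space $\mathcal M_{p,\phi}(\mathbb R^n)$ is the set of measurable functions $f$ with finite $$\|f\|_{\mathcal M_{p,\phi}}=\sup_{Q\in\mathcal Q}\frac1{\phi(Q)}\Big(\frac1{|Q|}\int_Q|f(y)|^p\,dy\Big)^{1/p}.$$ *)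

theory Defs
  imports "HOL-Analysis.Analysis"
begin

definition cube :: "real^'n \<Rightarrow> real \<Rightarrow> (real^'n) set" where
  "cube c l = cbox (c - vec (l / 2)) (c + vec (l / 2))"

definition cubes :: "(real^'n) set set" where
  "cubes = {cube c l | c l. 0 < l}"

definition cube_center :: "(real^'n) set \<Rightarrow> real^'n" where
  "cube_center Q = (THE c. \<exists>l>0. Q = cube c l)"

definition cube_side :: "(real^'n) set \<Rightarrow> real" where
  "cube_side Q = measure lebesgue Q powr (1 / real CARD('n))"

text \<open>Functions on \<open>\<real>\<^sup>n \<times> (0,\<infinity>)\<close> are total curried functions here; their values at nonpositive
  second arguments are never used.\<close>

definition on_cube :: "(real^'n \<Rightarrow> real \<Rightarrow> real) \<Rightarrow> (real^'n) set \<Rightarrow> real" where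
  "on_cube \<phi> Q = \<phi> (cube_center Q) (cube_side Q)"

definition G_class :: "real \<Rightarrow> (real^'n \<Rightarrow> real \<Rightarrow> real) set" where
  "G_class p = {\<phi>. (\<forall>x r. 0 < r \<longrightarrow> 0 < \<phi> x r) \<and>
     (\<exists>C>0. \<forall>x r s. 0 < s \<longrightarrow> s \<le> r \<longrightarrow>
        \<phi> x r \<le> \<phi> x s \<and>
        C * (\<phi> x r * r powr (real CARD('n) / p)) \<ge> \<phi> x s * s powr (real CARD('n) / p))}"

text \<open>The additional compatibility condition imposed throughout on members of \<open>G_class p\<close>;
  \<^const>\<open>infnorm\<close> is the maximum norm.\<close>

definition G_compat :: "real \<Rightarrow> (real^'n \<Rightarrow> real \<Rightarrow> real) \<Rightarrow> bool" where
  "G_compat p \<phi> \<longleftrightarrow> (\<forall>x y r s. 0 < r \<longrightarrow> 0 < s \<longrightarrow> infnorm (x - y) \<le> r - s \<longrightarrow>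
     \<phi> y s * s powr (real CARD('n) / p) \<le> \<phi> x r * r powr (real CARD('n) / p))"

text \<open>Powers of extended nonnegative numbers, for exponents \<open>a > 0\<close>.\<close>

definition ennpowr :: "ennreal \<Rightarrow> real \<Rightarrow> ennreal" where
  "ennpowr x a = (if x = \<infinity> then \<infinity> else ennreal (enn2real x powr a))"

text \<open>The Morrey norm is defined for \<open>[0,\<infinity>]\<close>-valued functions, so that it also makes sense for
  a series of nonnegative functions that may diverge at some points. For a complex-valued
  function it is the norm of the modulus.\<close>

definition morrey_gauge ::
    "real \<Rightarrow> (real^'n \<Rightarrow> real \<Rightarrow> real) \<Rightarrow> (real^'n \<Rightarrow> ennreal) \<Rightarrow> ennreal" where
  "morrey_gauge p \<phi> g = (SUP Q\<in>cubes. ennreal (1 / on_cube \<phi> Q) *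
     ennpowr (ennreal (1 / measure lebesgue Q) * (\<integral>\<^sup>+y\<in>Q. ennpowr (g y) p \<partial>lebesgue)) (1 / p))"

definition morrey_norm ::
    "real \<Rightarrow> (real^'n \<Rightarrow> real \<Rightarrow> real) \<Rightarrow> (real^'n \<Rightarrow> complex) \<Rightarrow> ennreal" where
  "morrey_norm p \<phi> f = morrey_gauge p \<phi> (\<lambda>y. ennreal (cmod (f y)))"

definition morrey_space ::
    "real \<Rightarrow> (real^'n \<Rightarrow> real \<Rightarrow> real) \<Rightarrow> (real^'n \<Rightarrow> complex) set" where
  "morrey_space p \<phi> = {f \<in> borel_measurable lebesgue. morrey_norm p \<phi> f < \<infinity>}"

text \<open>Support of an almost-everywhere class: the complement of the largest open set on which
  the function vanishes almost everywhere.\<close>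

definition ess_support :: "(real^'n \<Rightarrow> complex) \<Rightarrow> (real^'n) set" where
  "ess_support f = - \<Union>{U. open U \<and> (AE x in lebesgue. x \<in> U \<longrightarrow> f x = 0)}"

definition L1_loc :: "(real^'n \<Rightarrow> complex) set" where
  "L1_loc = {f \<in> borel_measurable lebesgue. \<forall>K. compact K \<longrightarrow> set_integrable lebesgue K f}"

text \<open>Convergence in the topology given by the seminorms \<open>f \<mapsto> \<integral>\<^sub>K |f|\<close>, \<open>K\<close> compact. The
  convergence is absolute if each of these seminorms is summable along the series.\<close>

definition L1_loc_sums ::
    "(nat \<Rightarrow> real^'n \<Rightarrow> complex) \<Rightarrow> (real^'n \<Rightarrow> complex) \<Rightarrow> bool" where
  "L1_loc_sums u f \<longleftrightarrow> (\<forall>j. u j \<in> L1_loc) \<and> f \<in> L1_loc \<and>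
     (\<forall>K. compact K \<longrightarrow>
       (\<lambda>N. LINT x:K|lebesgue. cmod (f x - (\<Sum>j<N. u j x))) \<longlonglongrightarrow> 0)"

definition L1_loc_abs_summable :: "(nat \<Rightarrow> real^'n \<Rightarrow> complex) \<Rightarrow> bool" where
  "L1_loc_abs_summable u \<longleftrightarrow> (\<forall>j. u j \<in> L1_loc) \<and>
     (\<forall>K. compact K \<longrightarrow> summable (\<lambda>j. LINT x:K|lebesgue. cmod (u j x)))"

lemma cube_inj:
  assumes "0 < l" "cube c l = cube c' l'"
  shows "c = c' \<and> l = l'"
proof -
  have "cbox (c - vec (l / 2)) (c + vec (l / 2)) \<noteq> {}"
    using assms(1) by (simp add: interval_ne_empty_cart)
  then have *: "c - vec (l / 2) = c' - vec (l' / 2)" "c + vec (l / 2) = c' + vec (l' / 2)"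
    using assms(2) by (auto simp: cube_def eq_cbox)
  have "c $ i = c' $ i \<and> l = l'" for i
    using arg_cong[OF *(1), of "\<lambda>v. v $ i"] arg_cong[OF *(2), of "\<lambda>v. v $ i"]
    by (simp add: vec_def)
  then show ?thesis by (simp add: vec_eq_iff)
qed

lemma cube_center_cube: "0 < l \<Longrightarrow> cube_center (cube c l) = c"
  unfolding cube_center_def by (rule the_equality) (use cube_inj in blast)+

lemma measure_cube:
  fixes c :: "real^'n"
  assumes "0 < l"
  shows "measure lebesgue (cube c l) = l ^ CARD('n)"
proof -
  have "cbox (c - vec (l / 2)) (c + vec (l / 2)) \<noteq> {}"
    using assms by (simp add: interval_ne_empty_cart)
  then show ?thesis
    by (simp add: cube_def content_cbox_cart)
qed

lemma cube_side_cube: "0 < l \<Longrightarrow> cube_side (cube c l) = l"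
  by (simp add: cube_side_def measure_cube powr_realpow[symmetric] powr_powr)

lemma ennpowr_one [simp]: "ennpowr x 1 = x"
  by (auto simp: ennpowr_def less_top)

end

theory Submission
  imports Defs
begin

text \<open>
  Write \<open>A\<close> for the Morrey norm of \<open>\<Sum>j. \<lambda>\<^sub>j \<chi>(Q\<^sub>j)\<close> and \<open>n\<close> for the dimension. Everything follows from one
  estimate: for every cube \<open>R\<close> with centre \<open>c\<close> and side \<open>l\<close>, the sum \<open>\<Sum>j. \<lambda>\<^sub>j \<integral>\<^sub>R |a\<^sub>j|\<close> is at most
  a constant times \<open>\<phi>(R) |R| A\<close> (\<open>atoms_sum_integral_le\<close>).

  Two facts about the cubes give it. First, by the definition of the norm on a cube \<open>S\<close>, the total
  mass \<open>\<Sum> \<lambda>\<^sub>j |Q\<^sub>j|\<close> of those \<open>Q\<^sub>j\<close> that lie inside \<open>S\<close> is at most \<open>\<phi>(S) |S| A\<close>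
  (\<open>sum_cubes_le_gauge\<close>). Second, if \<open>Q\<^sub>j\<close> meets \<open>R\<close> then for some \<open>k\<close> it lies in the cube
  about \<open>c\<close> of side \<open>5 \<cdot> 2\<^sup>k l\<close>, and \<open>\<integral>\<^sub>R |a\<^sub>j|\<close> is at most
  \<open>4\<^sup>n \<eta>(R) |R| / (\<eta>(c, 2\<^sup>k l) (2\<^sup>k l)\<^sup>n)\<close> times \<open>|Q\<^sub>j|\<close> (\<open>atom_integral_le\<close>). For \<open>Q\<^sub>j\<close> no larger
  than \<open>R\<close> this is the size of the atom on its own cube, with \<open>k = 0\<close>; for larger \<open>Q\<^sub>j\<close> it is the size of the
  atom on \<open>R\<close>, the number \<open>2\<^sup>k l\<close> is the side of \<open>Q\<^sub>j\<close> up to a factor two, and the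
  compatibility condition on \<open>\<eta>\<close> allows the centre to be moved from \<open>Q\<^sub>j\<close> to \<open>c\<close>.

  Summing over \<open>j\<close> for fixed \<open>k\<close> leaves \<open>20\<^sup>n \<eta>(R) |R| A \<cdot> \<phi>(c, 2\<^sup>k l) / \<eta>(c, 2\<^sup>k l)\<close>. The
  sum over \<open>k\<close> of the quotients is a Riemann sum for the integral in the hypothesis, so that it is
  dominated by \<open>\<phi>(R) / \<eta>(R)\<close> (\<open>dyadic_ratio_sum_le\<close>), and \<open>\<eta>(R)\<close> cancels.

  As every compact set lies in a cube, the estimate gives absolute convergence, hence convergence
  because the space of locally integrable functions is complete
  (\<open>L1_loc_abs_summable_imp_sums\<close>). The integral of \<open>|f|\<close> over \<open>R\<close> is at most the sum of the
  integrals of the terms (\<open>L1_loc_sums_nn_integral_le\<close>), which is the norm bound.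
\<close>

section \<open>Cubes\<close>

lemma mem_cube_iff:
  fixes c x :: "real^'n"
  shows "x \<in> cube c l \<longleftrightarrow> (\<forall>i. \<bar>x $ i - c $ i\<bar> \<le> l / 2)"
proof -
  have "c $ i - l / 2 \<le> x $ i \<and> x $ i \<le> c $ i + l / 2 \<longleftrightarrow> \<bar>x $ i - c $ i\<bar> \<le> l / 2" for i
    by linarith
  then show ?thesis by (simp add: cube_def mem_box_cart vec_def)
qed

lemma infnorm_le_iff_cart:
  fixes x :: "real^'n"
  shows "infnorm x \<le> r \<longleftrightarrow> (\<forall>i. \<bar>x $ i\<bar> \<le> r)"
proof
  show "infnorm x \<le> r \<Longrightarrow> \<forall>i. \<bar>x $ i\<bar> \<le> r"
    using component_le_infnorm_cart order_trans by blast
  show "\<forall>i. \<bar>x $ i\<bar> \<le> r \<Longrightarrow> infnorm x \<le> r"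
    unfolding infnorm_cart by (rule cSup_least) auto
qed

lemma infnorm_centers_of_meeting_cubes:
  fixes c q :: "real^'n"
  assumes "x \<in> cube c l" "x \<in> cube q L"
  shows "infnorm (q - c) \<le> (l + L) / 2"
proof -
  have "\<bar>(q - c) $ i\<bar> \<le> (l + L) / 2" for i
  proof -
    have "\<bar>x $ i - c $ i\<bar> \<le> l / 2" "\<bar>x $ i - q $ i\<bar> \<le> L / 2"
      using assms unfolding mem_cube_iff by blast+
    then show ?thesis unfolding vector_minus_component by argo
  qed
  then show ?thesis unfolding infnorm_le_iff_cart by blast
qed

lemma cube_subset_of_meeting:
  fixes c q :: "real^'n"
  assumes "x \<in> cube c l" "x \<in> cube q L" "l + 2 * L \<le> S"
  shows "cube q L \<subseteq> cube c S"
proof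
  fix y assume y: "y \<in> cube q L"
  have "\<bar>y $ i - c $ i\<bar> \<le> S / 2" for i
  proof -
    have "\<bar>x $ i - c $ i\<bar> \<le> l / 2" "\<bar>x $ i - q $ i\<bar> \<le> L / 2" "\<bar>y $ i - q $ i\<bar> \<le> L / 2"
      using assms(1,2) y unfolding mem_cube_iff by blast+
    then show ?thesis using assms(3) by linarith
  qed
  then show "y \<in> cube c S" by (simp add: mem_cube_iff)
qed

lemma cube_sets_lebesgue [measurable]: "cube c l \<in> sets lebesgue"
  by (simp add: cube_def)

lemma emeasure_cube:
  fixes c :: "real^'n"
  assumes "0 < l"
  shows "emeasure lebesgue (cube c l) = ennreal (l ^ CARD('n))"
  using emeasure_eq_measure2[of "cube c l" lebesgue] measure_cube[OF assms, of c]
  by (simp add: cube_def)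

lemma compact_subset_cube:
  fixes K :: "(real^'n) set"
  assumes "compact K"
  obtains l where "0 < l" "K \<subseteq> cube 0 l"
proof -
  obtain B where B: "0 < B" "\<And>x. x \<in> K \<Longrightarrow> norm x \<le> B"
    using compact_imp_bounded[OF assms] bounded_pos by blast
  have "K \<subseteq> cube 0 (2 * B)"
    using B(2) component_le_norm_cart order_trans by (fastforce simp: mem_cube_iff)
  with B(1) show ?thesis by (intro that[of "2 * B"]) auto
qed

section \<open>The classes of growth functions\<close>

lemma G_class_pos: "\<phi> \<in> G_class p \<Longrightarrow> 0 < r \<Longrightarrow> 0 < \<phi> x r"
  by (simp add: G_class_def)

lemma G_class_antimono: "\<phi> \<in> G_class p \<Longrightarrow> 0 < s \<Longrightarrow> s \<le> r \<Longrightarrow> \<phi> x r \<le> \<phi> x s"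
  by (auto simp: G_class_def)

lemma G_compat_1:
  fixes \<phi> :: "real^'n \<Rightarrow> real \<Rightarrow> real"
  assumes "G_compat 1 \<phi>" "0 < r" "0 < s" "infnorm (x - y) \<le> r - s"
  shows "\<phi> y s * s ^ CARD('n) \<le> \<phi> x r * r ^ CARD('n)"
  using assms by (simp add: G_compat_def powr_realpow)

lemma G_compat_1_same:
  fixes \<phi> :: "real^'n \<Rightarrow> real \<Rightarrow> real"
  assumes "G_compat 1 \<phi>" "0 < s" "s \<le> r"
  shows "\<phi> x s * s ^ CARD('n) \<le> \<phi> x r * r ^ CARD('n)"
  using G_compat_1[OF assms(1), of r s x x] assms(2,3) by (simp add: infnorm_0)

text \<open>The value at a scale \<open>s\<close> comparable to \<open>L\<close> is controlled by the value at a cube of side \<open>L\<close> with a nearby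
  centre. The compatibility condition needs a gap between the scales, at least the distance of the
  centres; passing to \<open>2 * L\<close> creates it, monotonicity returns to \<open>L\<close>, and the volumes cost
  \<open>(2 * L / s) ^ n \<le> 4 ^ n\<close>.\<close>

lemma G_scale:
  fixes \<phi> :: "real^'n \<Rightarrow> real \<Rightarrow> real"
  assumes \<phi>: "\<phi> \<in> G_class 1" "G_compat 1 \<phi>"
    and s: "0 < s" "s \<le> L" "L \<le> 2 * s" and d: "infnorm (q - c) \<le> L"
  shows "\<phi> c s \<le> 4 ^ CARD('n) * \<phi> q L"
proof -
  let ?n = "CARD('n)"
  have "\<phi> c s * s ^ ?n \<le> \<phi> q (2 * L) * (2 * L) ^ ?n"
    using s d by (intro G_compat_1[OF \<phi>(2)]) auto
  also have "\<dots> \<le> \<phi> q L * (4 * s) ^ ?n"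
    using s G_class_antimono[OF \<phi>(1), of L "2 * L" q] G_class_pos[OF \<phi>(1), of L q]
    by (intro mult_mono[OF _ power_mono]) auto
  finally have "\<phi> c s * s ^ ?n \<le> (4 ^ ?n * \<phi> q L) * s ^ ?n"
    by (simp add: power_mult_distrib mult_ac)
  then show ?thesis using s(1) by simp
qed

section \<open>Dyadic sums\<close>

lemma dyadic_scale_exists:
  fixes l L :: real
  assumes "0 < l" "l < L"
  obtains k where "2 ^ k * l < L" "L \<le> 2 ^ Suc k * l"
proof -
  obtain m where "L / l < 2 ^ m" using real_arch_pow[of 2 "L / l"] by auto
  then have ex: "L \<le> 2 ^ m * l" using assms by (simp add: field_simps)
  define m0 where "m0 = (LEAST m. L \<le> 2 ^ m * l)"
  have m0: "L \<le> 2 ^ m0 * l" unfolding m0_def using ex by (rule LeastI)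
  then obtain k where k: "m0 = Suc k" using assms by (cases m0) auto
  then have "\<not> L \<le> 2 ^ k * l" using not_less_Least[of k "\<lambda>m. L \<le> 2 ^ m * l"] m0_def by auto
  with m0 k show ?thesis by (intro that[of k]) auto
qed

lemma disjoint_dyadic_intervals:
  fixes l :: real
  assumes "0 < l"
  shows "disjoint_family (\<lambda>k. {2 ^ k * l ..< 2 ^ Suc k * l})"
proof -
  have "{2 ^ k * l ..< 2 ^ Suc k * l} \<inter> {2 ^ m * l ..< 2 ^ Suc m * l} = {}" if "k < m" for k m
  proof -
    have "(2::real) ^ Suc k * l \<le> 2 ^ m * l"
      using that assms by (intro mult_right_mono power_increasing) auto
    then show ?thesis by auto
  qed
  then show ?thesis
    unfolding disjoint_family_on_def by (metis Int_commute nat_neq_iff)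
qed

text \<open>On the interval between \<open>r / 2\<close> and \<open>r\<close>, where \<open>r = 2 ^ Suc k * l\<close>, the integrand is at
  least \<open>\<phi> x r / (2 ^ n * \<eta> x r * r)\<close>: \<open>\<phi>\<close> decreases, while \<open>\<eta> x s * s ^ n\<close> increases and therefore \<open>\<eta>\<close>
  loses at most the factor \<open>2 ^ n\<close>. The length \<open>r / 2\<close> of the interval supplies the last factor
  two. These lower bounds form a step function below the integrand.\<close>

lemma dyadic_sum_le_integral:
  fixes \<phi> \<eta> :: "real^'n \<Rightarrow> real \<Rightarrow> real"
  assumes \<phi>: "\<phi> \<in> G_class 1" and \<eta>: "\<eta> \<in> G_class 1" "G_compat 1 \<eta>" and l: "0 < l"
  shows "(\<Sum>k. ennreal (\<phi> x (2 ^ Suc k * l) / \<eta> x (2 ^ Suc k * l)))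
    \<le> ennreal (2 ^ Suc CARD('n)) * (\<integral>\<^sup>+s\<in>{l..}. ennreal (\<phi> x s / (\<eta> x s * s)) \<partial>lborel)"
proof -
  let ?n = "CARD('n)"
  define I where "I k = {2 ^ k * l ..< 2 ^ Suc k * l}" for k
  define r where "r k = 2 ^ Suc k * l" for k
  define v where "v k = \<phi> x (r k) / (2 ^ ?n * \<eta> x (r k) * r k)" for k
  have r: "0 < r k" for k using l by (simp add: r_def)
  have v0: "0 \<le> v k" for k
    using r[of k] G_class_pos[OF \<phi> r] G_class_pos[OF \<eta>(1) r] by (simp add: v_def less_imp_le)
  have int: "ennreal (\<phi> x (r k) / \<eta> x (r k))
      = ennreal (2 ^ Suc ?n) * (\<integral>\<^sup>+s. ennreal (v k) * indicator (I k) s \<partial>lborel)" for k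
  proof -
    have "(\<integral>\<^sup>+s. ennreal (v k) * indicator (I k) s \<partial>lborel) = ennreal (v k) * ennreal (r k / 2)"
      using l by (simp add: nn_integral_cmult_indicator I_def r_def mult.commute)
    moreover have "2 ^ Suc ?n * (v k * (r k / 2)) = \<phi> x (r k) / \<eta> x (r k)"
      using r[of k] G_class_pos[OF \<eta>(1) r, of x k] by (simp add: v_def field_simps)
    ultimately show ?thesis
      using v0[of k] r[of k] by (simp flip: ennreal_mult)
  qed
  have le: "(\<Sum>k. ennreal (v k) * indicator (I k) s) \<le> ennreal (\<phi> x s / (\<eta> x s * s)) * indicator {l..} s"
    for s
  proof (cases "\<exists>k. s \<in> I k")
    case True
    then obtain k where k: "s \<in> I k" by blast
    have sl: "l \<le> s"
    proof -
      have "1 * l \<le> 2 ^ k * l" using l by (intro mult_right_mono) auto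
      then show ?thesis using k by (simp add: I_def)
    qed
    have sr: "s \<le> r k" "r k \<le> 2 * s" using k by (auto simp: I_def r_def)
    have s0: "0 < s" using sl l by simp
    have "\<eta> x s * s ^ ?n \<le> \<eta> x (r k) * r k ^ ?n"
      using G_compat_1_same[OF \<eta>(2) s0 sr(1)] .
    also have "\<dots> \<le> \<eta> x (r k) * (2 * s) ^ ?n"
      using G_class_pos[OF \<eta>(1) r, of x k] sr(2) r[of k] by (intro mult_left_mono power_mono) auto
    finally have "\<eta> x s * s ^ ?n \<le> (2 ^ ?n * \<eta> x (r k)) * s ^ ?n"
      by (simp add: power_mult_distrib mult_ac)
    then have e: "\<eta> x s \<le> 2 ^ ?n * \<eta> x (r k)" using s0 by simp
    have "v k \<le> \<phi> x s / (\<eta> x s * s)"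
      unfolding v_def
      using e sr s0 r[of k] G_class_pos[OF \<eta>(1) s0, of x] G_class_pos[OF \<eta>(1) r, of x k]
        G_class_pos[OF \<phi> s0, of x] G_class_antimono[OF \<phi> s0 sr(1), of x]
      by (intro frac_le mult_mono mult_pos_pos) auto
    moreover have "(\<Sum>k. ennreal (v k) * indicator (I k) s) = ennreal (v k)"
      using disjoint_dyadic_intervals[OF l] k unfolding I_def
      by (intro suminf_cmult_indicator) auto
    ultimately show ?thesis using sl by (simp add: ennreal_leI)
  next
    case False
    then show ?thesis by (simp add: indicator_def)
  qed
  have "(\<Sum>k. ennreal (\<phi> x (r k) / \<eta> x (r k)))
      = ennreal (2 ^ Suc ?n) * (\<Sum>k. \<integral>\<^sup>+s. ennreal (v k) * indicator (I k) s \<partial>lborel)"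
    unfolding int by (rule ennreal_suminf_cmult)
  also have "(\<Sum>k. \<integral>\<^sup>+s. ennreal (v k) * indicator (I k) s \<partial>lborel)
      = (\<integral>\<^sup>+s. (\<Sum>k. ennreal (v k) * indicator (I k) s) \<partial>lborel)"
    by (rule nn_integral_suminf[symmetric]) (simp add: I_def)
  also have "ennreal (2 ^ Suc ?n) * \<dots>
      \<le> ennreal (2 ^ Suc ?n) * (\<integral>\<^sup>+s\<in>{l..}. ennreal (\<phi> x s / (\<eta> x s * s)) \<partial>lborel)"
    by (intro mult_left_mono nn_integral_mono le) auto
  finally show ?thesis by (simp add: r_def)
qed

text \<open>The integral starts at \<open>l\<close> and sees only the scales from \<open>2 * l\<close> on; the term at scale \<open>l\<close>
  is the summand \<open>1\<close> in the constant.\<close>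

lemma dyadic_ratio_sum_le:
  fixes \<phi> \<eta> :: "real^'n \<Rightarrow> real \<Rightarrow> real"
  assumes \<phi>: "\<phi> \<in> G_class 1" and \<eta>: "\<eta> \<in> G_class 1" "G_compat 1 \<eta>" and l: "0 < l" and C0: "0 < C0"
    and int: "(\<integral>\<^sup>+s\<in>{l..}. ennreal (\<phi> x s / (\<eta> x s * s)) \<partial>lborel) \<le> ennreal (C0 * (\<phi> x l / \<eta> x l))"
  shows "(\<Sum>k. ennreal (\<phi> x (2 ^ k * l) / \<eta> x (2 ^ k * l)))
    \<le> ennreal ((1 + 2 ^ Suc CARD('n) * C0) * (\<phi> x l / \<eta> x l))"
proof -
  let ?n = "CARD('n)" and ?f = "\<lambda>k. ennreal (\<phi> x (2 ^ k * l) / \<eta> x (2 ^ k * l))"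
  have q: "0 \<le> \<phi> x l / \<eta> x l" using G_class_pos[OF \<phi> l] G_class_pos[OF \<eta>(1) l] by (simp add: less_imp_le)
  have "(\<Sum>k. ?f k) = (\<Sum>k. ?f (Suc k)) + ?f 0"
    using suminf_offset[of ?f 1] by (simp add: add.commute)
  also have "(\<Sum>k. ?f (Suc k)) \<le> ennreal (2 ^ Suc ?n) * ennreal (C0 * (\<phi> x l / \<eta> x l))"
    by (rule order_trans[OF dyadic_sum_le_integral[OF \<phi> \<eta> l]]) (intro mult_left_mono int, simp)
  also have "ennreal (2 ^ Suc ?n) * ennreal (C0 * (\<phi> x l / \<eta> x l)) + ?f 0
      = ennreal ((1 + 2 ^ Suc ?n * C0) * (\<phi> x l / \<eta> x l))"
  proof -
    define z where "z = \<phi> x l / \<eta> x l"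
    have z: "0 \<le> z" using q by (simp add: z_def)
    have "ennreal (2 ^ Suc ?n) * ennreal (C0 * z) + ennreal z = ennreal (2 ^ Suc ?n * (C0 * z) + z)"
      using z C0 by (subst ennreal_plus) (simp_all flip: ennreal_mult)
    then show ?thesis by (simp add: z_def algebra_simps)
  qed
  finally show ?thesis by simp
qed

section \<open>The Morrey norm for exponent one\<close>

lemma morrey_gauge_1_ge:
  fixes \<phi> :: "real^'n \<Rightarrow> real \<Rightarrow> real"
  assumes \<phi>: "\<phi> \<in> G_class 1" and l: "0 < l"
  shows "(\<integral>\<^sup>+y\<in>cube c l. g y \<partial>lebesgue) \<le> ennreal (\<phi> c l * l ^ CARD('n)) * morrey_gauge 1 \<phi> g"
proof -
  let ?n = "CARD('n)" and ?I = "\<integral>\<^sup>+y\<in>cube c l. g y \<partial>lebesgue"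
  have p: "0 < \<phi> c l" using G_class_pos[OF \<phi> l] .
  have le: "ennreal (1 / \<phi> c l) * (ennreal (1 / l ^ ?n) * ?I) \<le> morrey_gauge 1 \<phi> g"
    unfolding morrey_gauge_def
    by (rule SUP_upper2[of "cube c l"])
      (use l in \<open>auto simp: cubes_def on_cube_def cube_center_cube cube_side_cube measure_cube\<close>)
  have "1 = ennreal (\<phi> c l * l ^ ?n) * (ennreal (1 / \<phi> c l) * ennreal (1 / l ^ ?n))"
    using p l by (simp flip: ennreal_mult)
  then have "?I = ennreal (\<phi> c l * l ^ ?n) * (ennreal (1 / \<phi> c l) * ennreal (1 / l ^ ?n)) * ?I"
    by simp
  also have "\<dots> = ennreal (\<phi> c l * l ^ ?n) * (ennreal (1 / \<phi> c l) * (ennreal (1 / l ^ ?n) * ?I))"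
    by (simp only: mult.assoc)
  also have "\<dots> \<le> ennreal (\<phi> c l * l ^ ?n) * morrey_gauge 1 \<phi> g"
    by (rule mult_left_mono[OF le]) simp
  finally show ?thesis .
qed

lemma morrey_gauge_1_le:
  fixes \<phi> :: "real^'n \<Rightarrow> real \<Rightarrow> real"
  assumes \<phi>: "\<phi> \<in> G_class 1"
    and le: "\<And>c l. 0 < l \<Longrightarrow> (\<integral>\<^sup>+y\<in>cube c l. g y \<partial>lebesgue) \<le> ennreal (\<phi> c l * l ^ CARD('n)) * B"
  shows "morrey_gauge 1 \<phi> g \<le> B"
  unfolding morrey_gauge_def
proof (rule SUP_least)
  let ?n = "CARD('n)"
  fix Q :: "(real^'n) set" assume "Q \<in> cubes"
  then obtain c l where Q: "Q = cube c l" and l: "0 < l" by (auto simp: cubes_def)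
  have p: "0 < \<phi> c l" using G_class_pos[OF \<phi> l] .
  have "ennreal (1 / \<phi> c l) * (ennreal (1 / l ^ ?n) * (\<integral>\<^sup>+y\<in>cube c l. g y \<partial>lebesgue))
      \<le> ennreal (1 / \<phi> c l) * (ennreal (1 / l ^ ?n) * (ennreal (\<phi> c l * l ^ ?n) * B))"
    by (intro mult_left_mono le l) auto
  also have "\<dots> = (ennreal (1 / \<phi> c l) * (ennreal (1 / l ^ ?n) * ennreal (\<phi> c l * l ^ ?n))) * B"
    by (simp add: mult.assoc)
  also have "ennreal (1 / \<phi> c l) * (ennreal (1 / l ^ ?n) * ennreal (\<phi> c l * l ^ ?n)) = 1"
    using p l by (simp flip: ennreal_mult)
  finally show "ennreal (1 / on_cube \<phi> Q) * ennpowr (ennreal (1 / measure lebesgue Q) *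
      (\<integral>\<^sup>+ y \<in> Q. ennpowr (g y) 1 \<partial>lebesgue)) (1 / 1) \<le> B"
    using l by (simp add: Q on_cube_def cube_center_cube cube_side_cube measure_cube)
qed

text \<open>A cube inside \<open>S\<close> contributes its whole volume to the integral of the indicator sum over \<open>S\<close>,
  and the norm bounds that integral.\<close>

lemma sum_cubes_le_gauge:
  fixes \<phi> :: "real^'n \<Rightarrow> real \<Rightarrow> real"
  assumes \<phi>: "\<phi> \<in> G_class 1" and S: "0 < S" and L: "\<And>j. 0 < L j"
  shows "(\<Sum>j. if cube (q j) (L j) \<subseteq> cube c S then ennreal (lam j) * ennreal (L j ^ CARD('n)) else 0)
    \<le> ennreal (\<phi> c S * S ^ CARD('n)) *
        morrey_gauge 1 \<phi> (\<lambda>x. \<Sum>j. ennreal (lam j) * indicator (cube (q j) (L j)) x)"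
proof -
  have "(\<Sum>j. if cube (q j) (L j) \<subseteq> cube c S then ennreal (lam j) * ennreal (L j ^ CARD('n)) else 0)
      \<le> (\<Sum>j. \<integral>\<^sup>+x. ennreal (lam j) * indicator (cube (q j) (L j)) x * indicator (cube c S) x \<partial>lebesgue)"
  proof (intro suminf_le summableI)
    fix j
    show "(if cube (q j) (L j) \<subseteq> cube c S then ennreal (lam j) * ennreal (L j ^ CARD('n)) else 0)
      \<le> (\<integral>\<^sup>+x. ennreal (lam j) * indicator (cube (q j) (L j)) x * indicator (cube c S) x \<partial>lebesgue)"
    proof (cases "cube (q j) (L j) \<subseteq> cube c S")
      case True
      then have "indicator (cube (q j) (L j)) x * indicator (cube c S) x
          = (indicator (cube (q j) (L j)) x :: ennreal)" for x
        by (auto simp: indicator_def)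
      then show ?thesis
        using True by (simp add: mult.assoc nn_integral_cmult_indicator emeasure_cube[OF L])
    qed simp
  qed
  also have "\<dots> = (\<integral>\<^sup>+x\<in>cube c S. (\<Sum>j. ennreal (lam j) * indicator (cube (q j) (L j)) x) \<partial>lebesgue)"
    by (subst nn_integral_suminf[symmetric]) auto
  also have "\<dots> \<le> ennreal (\<phi> c S * S ^ CARD('n)) *
        morrey_gauge 1 \<phi> (\<lambda>x. \<Sum>j. ennreal (lam j) * indicator (cube (q j) (L j)) x)"
    by (rule morrey_gauge_1_ge[OF \<phi> S])
  finally show ?thesis .
qed

section \<open>Atoms\<close>

text \<open>The complement of the support is a union of possibly uncountably many open sets on each of
  which the function vanishes almost everywhere; the Lindelof property leaves countably many.\<close>

lemma AE_zero_off_ess_support: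
  fixes f :: "real^'n \<Rightarrow> complex"
  shows "AE x in lebesgue. x \<notin> ess_support f \<longrightarrow> f x = 0"
proof -
  define \<U> where "\<U> = {U. open U \<and> (AE x in lebesgue. x \<in> U \<longrightarrow> f x = 0)}"
  obtain \<V> where V: "\<V> \<subseteq> \<U>" "countable \<V>" "\<Union>\<V> = \<Union>\<U>"
    using Lindelof[of \<U>] unfolding \<U>_def by blast
  have "AE x in lebesgue. \<forall>U\<in>\<V>. x \<in> U \<longrightarrow> f x = 0"
    using V(1) by (intro AE_ball_countable' V(2)) (auto simp: \<U>_def)
  then show ?thesis
    by eventually_elim (use V(3) in \<open>auto simp: ess_support_def \<U>_def\<close>)
qed

text \<open>In the case \<open>L \<le> l\<close> the support lets the integral over the small cube \<open>cube q L\<close> replace the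
  one over \<open>cube c l\<close>. In the other case the norm bound on \<open>cube c l\<close> itself is used, and the
  factor \<open>\<eta> q L\<close> is moved to the centre \<open>c\<close> and the dyadic scale below \<open>L\<close>. Bounding both by the volume of
  the atom's cube lets the contributions be summed through the norm of the indicator sum.\<close>

lemma atom_integral_le:
  fixes \<eta> :: "real^'n \<Rightarrow> real \<Rightarrow> real"
  assumes \<eta>: "\<eta> \<in> G_class 1" "G_compat 1 \<eta>" and l: "0 < l" and L: "0 < L"
    and norm: "morrey_gauge 1 \<eta> b \<le> ennreal (1 / \<eta> q L)"
    and supp: "AE x in lebesgue. x \<notin> cube q L \<longrightarrow> b x = 0"
    and ne: "x \<in> cube c l" "x \<in> cube q L"
  obtains k where "cube q L \<subseteq> cube c (5 * (2 ^ k * l))"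
    and "(\<integral>\<^sup>+y\<in>cube c l. b y \<partial>lebesgue)
      \<le> ennreal (4 ^ CARD('n) * (\<eta> c l * l ^ CARD('n))
          / (\<eta> c (2 ^ k * l) * (2 ^ k * l) ^ CARD('n))) * ennreal (L ^ CARD('n))"
proof -
  let ?n = "CARD('n)"
  have bd: "(\<integral>\<^sup>+y\<in>cube c' l'. b y \<partial>lebesgue) \<le> ennreal (\<eta> c' l' * l' ^ ?n / \<eta> q L)" if "0 < l'" for c' l'
  proof -
    have "(\<integral>\<^sup>+y\<in>cube c' l'. b y \<partial>lebesgue) \<le> ennreal (\<eta> c' l' * l' ^ ?n) * morrey_gauge 1 \<eta> b"
      by (rule morrey_gauge_1_ge[OF \<eta>(1) that])
    also have "\<dots> \<le> ennreal (\<eta> c' l' * l' ^ ?n) * ennreal (1 / \<eta> q L)"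
      by (rule mult_left_mono[OF norm]) simp
    also have "\<dots> = ennreal (\<eta> c' l' * l' ^ ?n / \<eta> q L)"
      using G_class_pos[OF \<eta>(1) that, of c'] G_class_pos[OF \<eta>(1) L, of q] that
      by (subst ennreal_mult[symmetric]) auto
    finally show ?thesis .
  qed
  show ?thesis
  proof (cases "L \<le> l")
    case True
    \<comment> \<open>Here the scale is \<open>k = 0\<close>, and the estimate holds with a factor \<open>4 ^ n\<close> to spare.\<close>
    have "(\<integral>\<^sup>+y\<in>cube c l. b y \<partial>lebesgue) \<le> (\<integral>\<^sup>+y\<in>cube q L. b y \<partial>lebesgue)"
      by (rule nn_integral_mono_AE) (use supp in \<open>eventually_elim; auto simp: indicator_def\<close>)
    also have "\<dots> \<le> ennreal (L ^ ?n)"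
      using bd[OF L, of q] G_class_pos[OF \<eta>(1) L, of q] by simp
    also have "\<dots> \<le> ennreal (4 ^ ?n * (\<eta> c l * l ^ ?n) / (\<eta> c l * l ^ ?n)) * ennreal (L ^ ?n)"
    proof -
      have "1 * L ^ ?n \<le> 4 ^ ?n * L ^ ?n" using L by (intro mult_right_mono) auto
      then show ?thesis
        using L l G_class_pos[OF \<eta>(1) l, of c] by (simp flip: ennreal_mult)
    qed
    finally show ?thesis
      using True L l cube_subset_of_meeting[OF ne, of "5 * l"] by (intro that[of 0]) auto
  next
    case False
    then obtain k where k: "2 ^ k * l < L" "L \<le> 2 ^ Suc k * l"
      using dyadic_scale_exists l not_le by metis
    define s where "s = 2 ^ k * l"
    have s: "0 < s" "s \<le> L" "L \<le> 2 * s" using k l by (auto simp: s_def)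
    have "l \<le> s"
    proof -
      have "1 * l \<le> 2 ^ k * l" using l by (intro mult_right_mono) auto
      then show ?thesis by (simp add: s_def)
    qed
    have p: "0 < \<eta> c s" "0 < \<eta> c l" "0 < \<eta> q L"
      using G_class_pos[OF \<eta>(1)] s l L by blast+
    have "infnorm (q - c) \<le> L"
      using infnorm_centers_of_meeting_cubes[OF ne] False by simp
    then have sc: "\<eta> c s \<le> 4 ^ ?n * \<eta> q L" by (rule G_scale[OF \<eta> s])
    have "\<eta> c l * l ^ ?n / \<eta> q L \<le> (4 ^ ?n * (\<eta> c l * l ^ ?n)) / \<eta> c s"
      using mult_left_mono[OF sc, of "\<eta> c l * l ^ ?n"] p l by (simp add: field_simps)
    also have "\<dots> \<le> (4 ^ ?n * (\<eta> c l * l ^ ?n)) / \<eta> c s * (L ^ ?n / s ^ ?n)"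
    proof -
      have "1 \<le> L ^ ?n / s ^ ?n" using s by (simp add: power_mono)
      moreover have "0 \<le> (4 ^ ?n * (\<eta> c l * l ^ ?n)) / \<eta> c s" using p l by (simp add: less_imp_le)
      ultimately show ?thesis using mult_left_mono by fastforce
    qed
    finally have "\<eta> c l * l ^ ?n / \<eta> q L \<le> 4 ^ ?n * (\<eta> c l * l ^ ?n) / (\<eta> c s * s ^ ?n) * L ^ ?n"
      by (simp add: mult_ac)
    then have "(\<integral>\<^sup>+y\<in>cube c l. b y \<partial>lebesgue)
        \<le> ennreal (4 ^ ?n * (\<eta> c l * l ^ ?n) / (\<eta> c s * s ^ ?n)) * ennreal (L ^ ?n)"
      using order_trans[OF bd[OF l, of c] ennreal_leI] L p s l by (simp flip: ennreal_mult)
    moreover have "cube q L \<subseteq> cube c (5 * s)"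
      using \<open>l \<le> s\<close> s by (intro cube_subset_of_meeting[OF ne]) auto
    ultimately show ?thesis by (intro that[of k]) (auto simp: s_def)
  qed
qed

lemma ennreal_suminf_commute:
  fixes f :: "nat \<Rightarrow> nat \<Rightarrow> ennreal"
  shows "(\<Sum>j. \<Sum>k. f j k) = (\<Sum>k. \<Sum>j. f j k)"
  using nn_integral_suminf[of "\<lambda>k j. f j k" "count_space UNIV"]
  by (simp add: nn_integral_count_space_nat)

text \<open>Each atom is estimated by a single scale \<open>k\<close>, but it is entered in the sum at every scale
  whose enlarged cube contains \<open>cube (q j) (L j)\<close>. This only increases the bound and avoids sorting
  the atoms by size. The constant combines \<open>4 ^ n\<close> from a single atom with \<open>5 ^ n\<close>, the volume ratio of
  the enlarged cubes.\<close>

lemma atoms_sum_integral_le: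
  fixes \<phi> \<eta> :: "real^'n \<Rightarrow> real \<Rightarrow> real"
  assumes \<phi>: "\<phi> \<in> G_class 1" and \<eta>: "\<eta> \<in> G_class 1" "G_compat 1 \<eta>" and C0: "0 < C0"
    and int: "\<And>x r. 0 < r \<Longrightarrow>
      (\<integral>\<^sup>+s\<in>{r..}. ennreal (\<phi> x s / (\<eta> x s * s)) \<partial>lborel) \<le> ennreal (C0 * (\<phi> x r / \<eta> x r))"
    and L: "\<And>j. 0 < L j"
    and norm: "\<And>j. morrey_gauge 1 \<eta> (b j) \<le> ennreal (1 / \<eta> (q j) (L j))"
    and supp: "\<And>j. AE x in lebesgue. x \<notin> cube (q j) (L j) \<longrightarrow> b j x = 0"
    and l: "0 < l"
  shows "(\<Sum>j. ennreal (lam j) * (\<integral>\<^sup>+y\<in>cube c l. b j y \<partial>lebesgue))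
    \<le> ennreal (\<phi> c l * l ^ CARD('n)) * (ennreal (20 ^ CARD('n) * (1 + 2 ^ Suc CARD('n) * C0)) *
        morrey_gauge 1 \<phi> (\<lambda>x. \<Sum>j. ennreal (lam j) * indicator (cube (q j) (L j)) x))"
proof -
  let ?n = "CARD('n)"
  define A where "A = morrey_gauge 1 \<phi> (\<lambda>x. \<Sum>j. ennreal (lam j) * indicator (cube (q j) (L j)) x)"
  define s where "s k = 2 ^ k * l" for k :: nat
  define w where "w k = 4 ^ ?n * (\<eta> c l * l ^ ?n) / (\<eta> c (s k) * s k ^ ?n)" for k
  define m where "m k j = (if cube (q j) (L j) \<subseteq> cube c (5 * s k)
    then ennreal (lam j) * ennreal (L j ^ ?n) else 0)" for k j
  have s: "0 < s k" for k using l by (simp add: s_def)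
  have p: "0 < \<phi> c l" "0 < \<eta> c l" "0 < \<phi> c (s k)" "0 < \<eta> c (s k)" for k
    using G_class_pos[OF \<phi>] G_class_pos[OF \<eta>(1)] l s by blast+
  have w0: "0 \<le> w k" for k using p s[of k] l by (simp add: w_def less_imp_le)
  \<comment> \<open>\<open>m k j\<close> is the mass of the \<open>j\<close>-th cube if the cube is visible at scale \<open>s k\<close>, and \<open>w k\<close> the weight of that
    scale.\<close>
  have one: "ennreal (lam j) * (\<integral>\<^sup>+y\<in>cube c l. b j y \<partial>lebesgue) \<le> (\<Sum>k. ennreal (w k) * m k j)" for j
  proof (cases "cube c l \<inter> cube (q j) (L j) = {}")
    case True
    have "AE y in lebesgue. b j y * indicator (cube c l) y = 0"
      using supp[of j] by eventually_elim (use True in \<open>auto simp: indicator_def\<close>)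
    then have "(\<integral>\<^sup>+y\<in>cube c l. b j y \<partial>lebesgue) = (\<integral>\<^sup>+y. 0 \<partial>(lebesgue :: (real^'n) measure))"
      by (rule nn_integral_cong_AE)
    then show ?thesis by simp
  next
    case False
    then obtain x where x: "x \<in> cube c l" "x \<in> cube (q j) (L j)" by auto
    obtain k where k: "cube (q j) (L j) \<subseteq> cube c (5 * s k)"
      "(\<integral>\<^sup>+y\<in>cube c l. b j y \<partial>lebesgue) \<le> ennreal (w k) * ennreal (L j ^ ?n)"
      by (rule atom_integral_le[OF \<eta> l L norm supp x]) (erule (1) that[unfolded w_def s_def])
    have "ennreal (lam j) * (\<integral>\<^sup>+y\<in>cube c l. b j y \<partial>lebesgue)
        \<le> ennreal (lam j) * (ennreal (w k) * ennreal (L j ^ ?n))"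
      by (intro mult_left_mono k(2)) auto
    also have "\<dots> = (\<Sum>i\<in>{k}. ennreal (w i) * m i j)" using k(1) by (simp add: m_def mult_ac)
    also have "\<dots> \<le> (\<Sum>k. ennreal (w k) * m k j)" by (intro sum_le_suminf summableI) auto
    finally show ?thesis .
  qed
  have "(\<Sum>j. ennreal (lam j) * (\<integral>\<^sup>+y\<in>cube c l. b j y \<partial>lebesgue))
      \<le> (\<Sum>j. \<Sum>k. ennreal (w k) * m k j)"
    by (intro suminf_le summableI one)
  also have "\<dots> = (\<Sum>k. ennreal (w k) * (\<Sum>j. m k j))"
    by (subst ennreal_suminf_commute) simp
  also have "\<dots> \<le> (\<Sum>k. ennreal (20 ^ ?n * (\<eta> c l * l ^ ?n)) * A * ennreal (\<phi> c (s k) / \<eta> c (s k)))"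
  proof (intro suminf_le summableI)
    fix k
    have "(\<Sum>j. m k j) \<le> ennreal (\<phi> c (5 * s k) * (5 * s k) ^ ?n) * A"
      unfolding m_def A_def using s[of k] by (intro sum_cubes_le_gauge \<phi> L) auto
    also have "\<dots> \<le> ennreal (\<phi> c (s k) * (5 * s k) ^ ?n) * A"
      using s[of k] by (intro mult_right_mono ennreal_leI G_class_antimono[OF \<phi>]) auto
    finally have "ennreal (w k) * (\<Sum>j. m k j)
        \<le> ennreal (w k) * (ennreal (\<phi> c (s k) * (5 * s k) ^ ?n) * A)"
      by (intro mult_left_mono) auto
    also have "\<dots> = ennreal (w k * (\<phi> c (s k) * (5 * s k) ^ ?n)) * A"
      using w0[of k] p s[of k] by (simp add: ennreal_mult mult.assoc less_imp_le)
    also have "w k * (\<phi> c (s k) * (5 * s k) ^ ?n)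
        = (20 ^ ?n * (\<eta> c l * l ^ ?n)) * (\<phi> c (s k) / \<eta> c (s k))"
    proof -
      have "(20::real) ^ ?n = 4 ^ ?n * 5 ^ ?n" by (simp flip: power_mult_distrib)
      then show ?thesis
        using p(4)[of k] s[of k] by (simp add: w_def power_mult_distrib field_simps)
    qed
    also have "ennreal \<dots> * A
        = ennreal (20 ^ ?n * (\<eta> c l * l ^ ?n)) * A * ennreal (\<phi> c (s k) / \<eta> c (s k))"
      using p(1,2) p(3,4)[of k] l by (subst ennreal_mult) (auto simp: mult_ac less_imp_le)
    finally show "ennreal (w k) * (\<Sum>j. m k j)
        \<le> ennreal (20 ^ ?n * (\<eta> c l * l ^ ?n)) * A * ennreal (\<phi> c (s k) / \<eta> c (s k))" .
  qed
  also have "\<dots> = ennreal (20 ^ ?n * (\<eta> c l * l ^ ?n)) * A * (\<Sum>k. ennreal (\<phi> c (s k) / \<eta> c (s k)))"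
    by simp
  also have "\<dots> \<le> ennreal (20 ^ ?n * (\<eta> c l * l ^ ?n)) * A *
      ennreal ((1 + 2 ^ Suc ?n * C0) * (\<phi> c l / \<eta> c l))"
    unfolding s_def by (intro mult_left_mono dyadic_ratio_sum_le \<phi> \<eta> l C0 int) auto
  also have "\<dots> = ennreal ((20 ^ ?n * (\<eta> c l * l ^ ?n)) * ((1 + 2 ^ Suc ?n * C0) * (\<phi> c l / \<eta> c l))) * A"
    using p l C0 by (subst ennreal_mult) (auto simp: mult_ac less_imp_le)
  also have "(20 ^ ?n * (\<eta> c l * l ^ ?n)) * ((1 + 2 ^ Suc ?n * C0) * (\<phi> c l / \<eta> c l))
      = (\<phi> c l * l ^ ?n) * (20 ^ ?n * (1 + 2 ^ Suc ?n * C0))"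
    using p by (simp add: field_simps)
  also have "ennreal \<dots> * A = ennreal (\<phi> c l * l ^ ?n) * (ennreal (20 ^ ?n * (1 + 2 ^ Suc ?n * C0)) * A)"
    using p l C0 by (subst ennreal_mult) (auto simp: mult_ac less_imp_le)
  finally show ?thesis unfolding A_def .
qed


section \<open>Completeness of the space of locally integrable functions\<close>

lemma set_integrable_cmod_eq_nn_integral:
  fixes f :: "'a \<Rightarrow> complex"
  assumes "set_integrable M K f"
  shows "(\<integral>\<^sup>+x\<in>K. ennreal (cmod (f x)) \<partial>M) = ennreal (LINT x:K|M. cmod (f x))"
proof -
  have "integrable M (\<lambda>x. indicat_real K x *\<^sub>R cmod (f x))"
    using integrable_norm[OF assms[unfolded set_integrable_def]] by simp
  then have "(\<integral>\<^sup>+x. ennreal (indicat_real K x *\<^sub>R cmod (f x)) \<partial>M) = ennreal (LINT x:K|M. cmod (f x))"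
    unfolding set_lebesgue_integral_def by (rule nn_integral_eq_integral) simp
  moreover have "ennreal (indicat_real K x *\<^sub>R cmod (f x)) = ennreal (cmod (f x)) * indicator K x" for x
    by (simp add: indicator_def)
  ultimately show ?thesis by simp
qed

lemma set_integrable_of_nn_integral_finite:
  fixes f :: "'a \<Rightarrow> complex"
  assumes [measurable]: "f \<in> borel_measurable M" "K \<in> sets M"
    and fin: "(\<integral>\<^sup>+x\<in>K. ennreal (cmod (f x)) \<partial>M) < \<infinity>"
  shows "set_integrable M K f"
  unfolding set_integrable_def
proof (rule integrableI_bounded)
  have "ennreal (norm (indicat_real K x *\<^sub>R f x)) = ennreal (cmod (f x)) * indicator K x" for x
    by (simp add: indicator_def)
  then show "(\<integral>\<^sup>+x. ennreal (norm (indicat_real K x *\<^sub>R f x)) \<partial>M) < \<infinity>"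
    using fin by simp
qed measurable

lemma compact_sets_lebesgue: "compact K \<Longrightarrow> K \<in> sets lebesgue"
  using borel_compact sets_completionI_sets by (metis sets_lborel)

text \<open>The limit is the pointwise sum, which converges absolutely almost everywhere because
  \<open>\<Sum>j. |u j|\<close> has a finite integral over each compact set; the remainders are
  then bounded by the tails of a convergent numerical series.\<close>

lemma L1_loc_abs_summable_imp_sums:
  fixes u :: "nat \<Rightarrow> real^'n \<Rightarrow> complex"
  assumes "L1_loc_abs_summable u"
  shows "\<exists>f. L1_loc_sums u f"
proof -
  have u: "u j \<in> L1_loc" for j using assms by (simp add: L1_loc_abs_summable_def)
  have um [measurable]: "u j \<in> borel_measurable lebesgue" for j using u by (simp add: L1_loc_def)
  define f where "f x = (\<Sum>j. u j x)" for x
  define a where "a K j = (LINT x:K|lebesgue. cmod (u j x))" for K j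
  \<comment> \<open>At points where the series diverges, \<open>f\<close> has the default value of \<open>suminf\<close>; they form a null set.\<close>
  have fm [measurable]: "f \<in> borel_measurable lebesgue" unfolding f_def by measurable
  have summ: "summable (a K)" if "compact K" for K
    using assms that unfolding L1_loc_abs_summable_def a_def by simp
  have a0: "0 \<le> a K j" for K j
    unfolding a_def set_lebesgue_integral_def by (intro Bochner_Integration.integral_nonneg) auto
  have nn: "(\<integral>\<^sup>+x\<in>K. ennreal (cmod (u j x)) \<partial>lebesgue) = ennreal (a K j)" if "compact K" for K j
    unfolding a_def using u that by (intro set_integrable_cmod_eq_nn_integral) (simp add: L1_loc_def)
  have tail: "(\<integral>\<^sup>+x\<in>K. ennreal (cmod (f x - (\<Sum>j<N. u j x))) \<partial>lebesgue) \<le> ennreal (\<Sum>j. a K (j + N))"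
    if K: "compact K" for K N
  proof -
    have [measurable]: "K \<in> sets lebesgue" using compact_sets_lebesgue[OF K] .
    have int: "(\<integral>\<^sup>+x. (\<Sum>j. ennreal (cmod (u (j + M) x)) * indicator K x) \<partial>lebesgue)
        = ennreal (\<Sum>j. a K (j + M))" for M
    proof -
      have "(\<integral>\<^sup>+x. (\<Sum>j. ennreal (cmod (u (j + M) x)) * indicator K x) \<partial>lebesgue)
          = (\<Sum>j. ennreal (a K (j + M)))"
        by (subst nn_integral_suminf) (auto simp: nn[OF K])
      also have "\<dots> = ennreal (\<Sum>j. a K (j + M))"
        by (intro suminf_ennreal2 a0) (use summ[OF K] in \<open>simp add: summable_iff_shift\<close>)
      finally show ?thesis .
    qed
    have "AE x in lebesgue. (\<Sum>j. ennreal (cmod (u (j + 0) x)) * indicator K x) \<noteq> \<infinity>"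
      by (rule nn_integral_PInf_AE) (use int[of 0] in auto)
    then have "AE x in lebesgue. ennreal (cmod (f x - (\<Sum>j<N. u j x))) * indicator K x
        \<le> (\<Sum>j. ennreal (cmod (u (j + N) x)) * indicator K x)"
    proof eventually_elim
      case (elim x)
      show ?case
      proof (cases "x \<in> K")
        case True
        with elim have "(\<Sum>j. ennreal (cmod (u j x))) \<noteq> top" by simp
        then have s: "summable (\<lambda>j. cmod (u j x))" by (intro summable_suminf_not_top) auto
        then have sN: "summable (\<lambda>j. cmod (u (j + N) x))"
          by (simp add: summable_iff_shift[of "\<lambda>j. cmod (u j x)"])
        have "cmod (f x - (\<Sum>j<N. u j x)) = cmod (\<Sum>j. u (j + N) x)"
          unfolding f_def by (simp add: suminf_minus_initial_segment[OF summable_norm_cancel[OF s]])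
        also have "\<dots> \<le> (\<Sum>j. cmod (u (j + N) x))" by (rule summable_norm[OF sN])
        finally have "ennreal (cmod (f x - (\<Sum>j<N. u j x))) \<le> (\<Sum>j. ennreal (cmod (u (j + N) x)))"
          by (subst suminf_ennreal2[OF _ sN]) (auto intro: ennreal_leI)
        then show ?thesis using True by simp
      qed simp
    qed
    then have "(\<integral>\<^sup>+x\<in>K. ennreal (cmod (f x - (\<Sum>j<N. u j x))) \<partial>lebesgue)
        \<le> (\<integral>\<^sup>+x. (\<Sum>j. ennreal (cmod (u (j + N) x)) * indicator K x) \<partial>lebesgue)"
      by (rule nn_integral_mono_AE)
    then show ?thesis unfolding int .
  qed
  have integrable: "set_integrable lebesgue K (\<lambda>x. f x - (\<Sum>j<N. u j x))" if "compact K" for K N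
    by (rule set_integrable_of_nn_integral_finite)
      (use tail[OF that, of N] compact_sets_lebesgue[OF that] in \<open>auto simp: le_less_trans\<close>)
  have "f \<in> L1_loc" using fm integrable[of _ 0] by (simp add: L1_loc_def)
  moreover have "(\<lambda>N. LINT x:K|lebesgue. cmod (f x - (\<Sum>j<N. u j x))) \<longlonglongrightarrow> 0" if K: "compact K" for K
  proof (rule tendsto_sandwich[of "\<lambda>_. 0" _ _ "\<lambda>N. (\<Sum>j. a K (j + N))"])
    have le: "(LINT x:K|lebesgue. cmod (f x - (\<Sum>j<N. u j x))) \<le> (\<Sum>j. a K (j + N))" for N
      using tail[OF K, of N] set_integrable_cmod_eq_nn_integral[OF integrable[OF K, of N]]
      by (simp add: suminf_nonneg summ[OF K] summable_iff_shift a0)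
    then show "\<forall>\<^sub>F N in sequentially. (LINT x:K|lebesgue. cmod (f x - (\<Sum>j<N. u j x))) \<le> (\<Sum>j. a K (j + N))"
      by simp
    show "\<forall>\<^sub>F N in sequentially. 0 \<le> (LINT x:K|lebesgue. cmod (f x - (\<Sum>j<N. u j x)))"
      by (intro always_eventually allI) (simp add: set_lebesgue_integral_def)
    have "(\<lambda>N. (\<Sum>j. a K j) - (\<Sum>j<N. a K j)) \<longlonglongrightarrow> (\<Sum>j. a K j) - (\<Sum>j. a K j)"
      by (intro tendsto_diff tendsto_const summable_LIMSEQ summ[OF K])
    then show "(\<lambda>N. (\<Sum>j. a K (j + N))) \<longlonglongrightarrow> 0"
      by (simp add: suminf_minus_initial_segment[OF summ[OF K]])
  qed simp
  ultimately show ?thesis using u unfolding L1_loc_sums_def by blast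
qed

text \<open>The triangle inequality for the partial sums, passed to the limit. Only integrals
  enter, so the bound holds for every representative of the sum.\<close>

lemma L1_loc_sums_nn_integral_le:
  fixes u :: "nat \<Rightarrow> real^'n \<Rightarrow> complex"
  assumes sums: "L1_loc_sums u f" and K: "compact K"
  shows "(\<integral>\<^sup>+x\<in>K. ennreal (cmod (f x)) \<partial>lebesgue) \<le> (\<Sum>j. \<integral>\<^sup>+x\<in>K. ennreal (cmod (u j x)) \<partial>lebesgue)"
proof -
  have u: "u j \<in> L1_loc" for j using sums by (simp add: L1_loc_sums_def)
  have f: "f \<in> L1_loc" using sums by (simp add: L1_loc_sums_def)
  have [measurable]: "u j \<in> borel_measurable lebesgue" "f \<in> borel_measurable lebesgue" "K \<in> sets lebesgue" for j
    using u f compact_sets_lebesgue[OF K] by (auto simp: L1_loc_def)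
  define e where "e N = (LINT x:K|lebesgue. cmod (f x - (\<Sum>j<N. u j x)))" for N
  let ?B = "\<Sum>j. \<integral>\<^sup>+x\<in>K. ennreal (cmod (u j x)) \<partial>lebesgue"
  have e: "e \<longlonglongrightarrow> 0" using sums K by (simp add: L1_loc_sums_def e_def[abs_def])
  have "(\<integral>\<^sup>+x\<in>K. ennreal (cmod (f x)) \<partial>lebesgue) \<le> ennreal (e N) + ?B" for N
  proof -
    have int: "set_integrable lebesgue K (\<lambda>x. f x - (\<Sum>j<N. u j x))"
      using u f K unfolding L1_loc_def set_integrable_def scaleR_diff_right scaleR_sum_right
      by (intro Bochner_Integration.integrable_diff Bochner_Integration.integrable_sum) auto
    have "(\<integral>\<^sup>+x\<in>K. ennreal (cmod (f x)) \<partial>lebesgue)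
      \<le> (\<integral>\<^sup>+x. ennreal (cmod (f x - (\<Sum>j<N. u j x))) * indicator K x
            + (\<Sum>j<N. ennreal (cmod (u j x)) * indicator K x) \<partial>lebesgue)"
    proof (rule nn_integral_mono)
      fix x
      have "cmod (f x) \<le> cmod (f x - (\<Sum>j<N. u j x)) + cmod (\<Sum>j<N. u j x)"
        by (metis diff_add_cancel norm_triangle_ineq)
      also have "\<dots> \<le> cmod (f x - (\<Sum>j<N. u j x)) + (\<Sum>j<N. cmod (u j x))"
        by (intro add_left_mono norm_sum)
      finally have "ennreal (cmod (f x)) \<le> ennreal (cmod (f x - (\<Sum>j<N. u j x)) + (\<Sum>j<N. cmod (u j x)))"
        by (rule ennreal_leI)
      also have "\<dots> = ennreal (cmod (f x - (\<Sum>j<N. u j x))) + (\<Sum>j<N. ennreal (cmod (u j x)))"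
        by (simp add: sum_nonneg)
      finally show "ennreal (cmod (f x)) * indicator K x
        \<le> ennreal (cmod (f x - (\<Sum>j<N. u j x))) * indicator K x
            + (\<Sum>j<N. ennreal (cmod (u j x)) * indicator K x)"
        by (simp add: indicator_def)
    qed
    also have "\<dots> = ennreal (e N) + (\<Sum>j<N. \<integral>\<^sup>+x\<in>K. ennreal (cmod (u j x)) \<partial>lebesgue)"
      unfolding e_def set_integrable_cmod_eq_nn_integral[OF int, symmetric]
      by (subst nn_integral_add; (subst nn_integral_sum)?) measurable
    also have "\<dots> \<le> ennreal (e N) + ?B"
      by (intro add_left_mono sum_le_suminf summableI) auto
    finally show ?thesis .
  qed
  moreover have "(\<lambda>N. ennreal (e N) + ?B) \<longlonglongrightarrow> ennreal 0 + ?B"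
    by (intro tendsto_add tendsto_ennrealI e tendsto_const)
  ultimately show ?thesis using LIMSEQ_le_const by fastforce
qed

section \<open>Sums of atoms in Morrey spaces\<close>

theorem theorem1p1:
  fixes \<phi> \<eta> :: "real^'n \<Rightarrow> real \<Rightarrow> real" and C0 :: real
  assumes "\<phi> \<in> G_class 1" and "G_compat 1 \<phi>"
    and "\<eta> \<in> G_class 1" and "G_compat 1 \<eta>"
    and "0 < C0"
    and "\<And>x r. 0 < r \<Longrightarrow>
      (\<integral>\<^sup>+s\<in>{r..}. ennreal (\<phi> x s / (\<eta> x s * s)) \<partial>lborel) \<le> ennreal (C0 * (\<phi> x r / \<eta> x r))"
  shows "\<exists>C>0. \<forall>(Q :: nat \<Rightarrow> (real^'n) set) (a :: nat \<Rightarrow> real^'n \<Rightarrow> complex) (lam :: nat \<Rightarrow> real).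
     (\<forall>j. Q j \<in> cubes) \<longrightarrow>
     (\<forall>j. a j \<in> morrey_space 1 \<eta>) \<longrightarrow>
     (\<forall>j. 0 \<le> lam j) \<longrightarrow>
     (\<forall>j. morrey_norm 1 \<eta> (a j) \<le> ennreal (1 / on_cube \<eta> (Q j))) \<longrightarrow>
     (\<forall>j. ess_support (a j) \<subseteq> Q j) \<longrightarrow>
     morrey_gauge 1 \<phi> (\<lambda>x. \<Sum>j. ennreal (lam j) * indicator (Q j) x) < \<infinity> \<longrightarrow>
       L1_loc_abs_summable (\<lambda>j x. complex_of_real (lam j) * a j x) \<and>
       (\<exists>f. L1_loc_sums (\<lambda>j x. complex_of_real (lam j) * a j x) f) \<and>
       (\<forall>f. L1_loc_sums (\<lambda>j x. complex_of_real (lam j) * a j x) f \<longrightarrow>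
          morrey_norm 1 \<phi> f
            \<le> ennreal C * morrey_gauge 1 \<phi> (\<lambda>x. \<Sum>j. ennreal (lam j) * indicator (Q j) x))"
proof -
  let ?n = "CARD('n)"
  define C where "C = 20 ^ ?n * (1 + 2 ^ Suc ?n * C0)"
  have C: "0 < C" unfolding C_def using \<open>0 < C0\<close> by (simp add: add_pos_pos)
  show ?thesis
  proof (rule exI[of _ C], intro conjI C allI impI)
    fix Q :: "nat \<Rightarrow> (real^'n) set" and a :: "nat \<Rightarrow> real^'n \<Rightarrow> complex" and lam :: "nat \<Rightarrow> real"
    assume Q: "\<forall>j. Q j \<in> cubes" and a: "\<forall>j. a j \<in> morrey_space 1 \<eta>" and lam: "\<forall>j. 0 \<le> lam j"
      and norm: "\<forall>j. morrey_norm 1 \<eta> (a j) \<le> ennreal (1 / on_cube \<eta> (Q j))"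
      and supp: "\<forall>j. ess_support (a j) \<subseteq> Q j"
      and fin: "morrey_gauge 1 \<phi> (\<lambda>x. \<Sum>j. ennreal (lam j) * indicator (Q j) x) < \<infinity>"
    let ?A = "morrey_gauge 1 \<phi> (\<lambda>x. \<Sum>j. ennreal (lam j) * indicator (Q j) x)"
    let ?u = "\<lambda>j x. complex_of_real (lam j) * a j x"
    have "\<forall>j. \<exists>q L. 0 < L \<and> Q j = cube q L" using Q unfolding cubes_def by blast
    then obtain q L where L: "0 < L j" and QL: "Q j = cube (q j) (L j)" for j by metis
    have am [measurable]: "a j \<in> borel_measurable lebesgue" for j
      using a by (simp add: morrey_space_def)
    have u_int: "(\<integral>\<^sup>+x\<in>K. ennreal (cmod (?u j x)) \<partial>lebesgue)
        = ennreal (lam j) * (\<integral>\<^sup>+x\<in>K. ennreal (cmod (a j x)) \<partial>lebesgue)" if "K \<in> sets lebesgue" for K j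
      using that lam by (subst nn_integral_cmult[symmetric]) (auto simp: norm_mult ennreal_mult mult.assoc)
    have bound: "(\<Sum>j. \<integral>\<^sup>+x\<in>cube c l. ennreal (cmod (?u j x)) \<partial>lebesgue)
        \<le> ennreal (\<phi> c l * l ^ ?n) * (ennreal C * ?A)" if l: "0 < l" for c l
      unfolding u_int[OF cube_sets_lebesgue] QL C_def
    proof (rule atoms_sum_integral_le[where \<eta> = \<eta>])
      show "morrey_gauge 1 \<eta> (\<lambda>y. ennreal (cmod (a j y))) \<le> ennreal (1 / \<eta> (q j) (L j))" for j
        using norm[rule_format, of j] L[of j]
        by (simp add: morrey_norm_def on_cube_def QL cube_center_cube cube_side_cube)
      show "AE x in lebesgue. x \<notin> cube (q j) (L j) \<longrightarrow> ennreal (cmod (a j x)) = 0" for j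
        using AE_zero_off_ess_support[of "a j"]
        by eventually_elim (use supp QL in auto)
    qed (use assms L l in auto)
    have bound_K: "(\<Sum>j. \<integral>\<^sup>+x\<in>K. ennreal (cmod (?u j x)) \<partial>lebesgue) < \<infinity>" if K: "compact K" for K
    proof -
      obtain l where l: "0 < l" "K \<subseteq> cube 0 l" using compact_subset_cube[OF K] .
      have "(\<Sum>j. \<integral>\<^sup>+x\<in>K. ennreal (cmod (?u j x)) \<partial>lebesgue)
          \<le> (\<Sum>j. \<integral>\<^sup>+x\<in>cube 0 l. ennreal (cmod (?u j x)) \<partial>lebesgue)"
        by (intro suminf_le summableI nn_set_integral_set_mono l)
      also have "\<dots> \<le> ennreal (\<phi> 0 l * l ^ ?n) * (ennreal C * ?A)" by (rule bound[OF l(1)])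
      also have "\<dots> < \<infinity>" using fin by (simp add: ennreal_mult_less_top)
      finally show ?thesis .
    qed
    have integrable: "set_integrable lebesgue K (?u j)" if "compact K" for K j
      by (rule set_integrable_of_nn_integral_finite)
        (use ennreal_suminf_lessD[OF bound_K[OF that]] compact_sets_lebesgue[OF that] in auto)
    have "summable (\<lambda>j. LINT x:K|lebesgue. cmod (?u j x))" if "compact K" for K
    proof (rule summable_suminf_not_top)
      show "0 \<le> (LINT x:K|lebesgue. cmod (?u j x))" for j by (simp add: set_lebesgue_integral_def)
      show "(\<Sum>j. ennreal (LINT x:K|lebesgue. cmod (?u j x))) \<noteq> top"
        using bound_K[OF that] unfolding set_integrable_cmod_eq_nn_integral[OF integrable[OF that]]
        by simp
    qed
    then show summ: "L1_loc_abs_summable ?u"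
      using integrable by (auto simp: L1_loc_abs_summable_def L1_loc_def)
    show "\<exists>f. L1_loc_sums ?u f" by (rule L1_loc_abs_summable_imp_sums[OF summ])
    fix f assume f: "L1_loc_sums ?u f"
    show "morrey_norm 1 \<phi> f \<le> ennreal C * ?A"
      unfolding morrey_norm_def
    proof (rule morrey_gauge_1_le[OF \<open>\<phi> \<in> G_class 1\<close>])
      fix c :: "real^'n" and l :: real assume l: "0 < l"
      have "compact (cube c l)" by (simp add: cube_def)
      then show "(\<integral>\<^sup>+y\<in>cube c l. ennreal (cmod (f y)) \<partial>lebesgue) \<le> ennreal (\<phi> c l * l ^ ?n) * (ennreal C * ?A)"
        using order_trans[OF L1_loc_sums_nn_integral_le[OF f] bound[OF l]] by blast
    qed
  qed
qed

end
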